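(* Let $D$ be a finite in-semicomplete digraph that contains no blocking odd cycle as an induced subdigraph. Then $D$ is BE-diperfect.
   Context: Digraphs have no loops and no parallel arcs, but may contain both arcs $uv$ and $vu$ (cycles of length two). Two vertices $u,v$ are adjacent if $uv$ or $vu$ is an arc. $U(D)$ is the simple graph on $V(D)$ whose edges are the pairs of vertices adjacent in $D$. A digraph is semicomplete if every two distinct vertices are adjacent. A digraph $D$ is in-semicomplete (locally in-semicomplete) if for every vertex $v$ the set of in-neighbors of $v$ induces a semicomplete digraph. A stable set is a set of pairwise non-adjacent vertices; it is maximum if no stable set has larger cardinality. A path of $D$ is a directed path, i.e. a sequence $v_1v_2\cdots v_\ell$ of distinct vertices ($\ell\ge 1$) with $v_iv_{i+1}\in A(D)$ for $1\le i<\ell$. A path partition of $D$ is a collection of paths whose vertex sets partition $V(D)$. For a stable set $S$, an $S_{\rm BE}$-path partition of $D$ is a path partition $\mathcal P$ such that every $P=x_1x_2\cdots x_k\in\mathcal P$ satisfies $V(P)\cap S=\{x\}$ with $x\in\{x_1,x_k\}$. A digraph satisfies the BE-property if it has an $S_{\rm BE}$-path partition for every maximum stable set $S$. A digraph is BE-diperfect if every induced subdigraph of it satisfies the BE-property. A source is a vertex with no in-neighbor, a sink is a vertex with no out-neighbor. A digraph $C$ is a blocking odd cycle if $U(C)$ is a cycle $x_1x_2\cdots x_{2k+1}x_1$ for some integer $k\ge 1$, and each of $x_1$ and $x_2$ is either a source or a sink in $C$. *)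

theory Defs
  imports
    "Graph_Theory.Digraph"
    "Graph_Theory.Digraph_Component"
    "Graph_Theory.Vertex_Walk"
    "HOL-Library.Disjoint_Sets"
begin

definition adjacent :: "('a, 'b) pre_digraph \<Rightarrow> 'a \<Rightarrow> 'a \<Rightarrow> bool" where
  "adjacent G u v \<longleftrightarrow> u \<rightarrow>\<^bsub>G\<^esub> v \<or> v \<rightarrow>\<^bsub>G\<^esub> u"

text \<open>
  The simple graph \<open>U(G)\<close> is represented by \<^const>\<open>mk_symmetric\<close>, with both orientations of
  every edge.
\<close>

lemma parcs_mk_symmetric_adjacent: "(u, v) \<in> parcs (mk_symmetric G) \<longleftrightarrow> adjacent G u v"
  by (auto simp: parcs_mk_symmetric adjacent_def arcs_ends_conv)

definition in_neighbors :: "('a, 'b) pre_digraph \<Rightarrow> 'a \<Rightarrow> 'a set" where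
  "in_neighbors G v = {u. u \<rightarrow>\<^bsub>G\<^esub> v}"

definition out_neighbors :: "('a, 'b) pre_digraph \<Rightarrow> 'a \<Rightarrow> 'a set" where
  "out_neighbors G v = {u. v \<rightarrow>\<^bsub>G\<^esub> u}"

definition semicomplete :: "('a, 'b) pre_digraph \<Rightarrow> bool" where
  "semicomplete G \<longleftrightarrow> pairwise (adjacent G) (verts G)"

definition in_semicomplete :: "('a, 'b) pre_digraph \<Rightarrow> bool" where
  "in_semicomplete G \<longleftrightarrow> (\<forall>v \<in> verts G. semicomplete (G \<restriction> in_neighbors G v))"

definition stable_set :: "('a, 'b) pre_digraph \<Rightarrow> 'a set \<Rightarrow> bool" where
  "stable_set G S \<longleftrightarrow> S \<subseteq> verts G \<and> pairwise (\<lambda>u v. \<not> adjacent G u v) S"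

text \<open>Meant for digraphs with finitely many vertices, since \<^const>\<open>card\<close> is 0 on infinite sets.\<close>

definition maximum_stable_set :: "('a, 'b) pre_digraph \<Rightarrow> 'a set \<Rightarrow> bool" where
  "maximum_stable_set G S \<longleftrightarrow> stable_set G S \<and> (\<forall>T. stable_set G T \<longrightarrow> card T \<le> card S)"

text \<open>
  Distinct members of \<open>P\<close> are vertex-disjoint; in particular two different paths
  on the same vertex set are excluded.
\<close>

definition path_partition :: "('a, 'b) pre_digraph \<Rightarrow> 'a list set \<Rightarrow> bool" where
  "path_partition G P \<longleftrightarrow>
     (\<forall>p \<in> P. vpath p G) \<and> disjoint_family_on set P \<and> (\<Union>p \<in> P. set p) = verts G"

definition BE_path_partition :: "('a, 'b) pre_digraph \<Rightarrow> 'a set \<Rightarrow> 'a list set \<Rightarrow> bool" where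
  "BE_path_partition G S P \<longleftrightarrow>
     path_partition G P \<and> (\<forall>p \<in> P. \<exists>x. set p \<inter> S = {x} \<and> x \<in> {hd p, last p})"

definition BE_property :: "('a, 'b) pre_digraph \<Rightarrow> bool" where
  "BE_property G \<longleftrightarrow> (\<forall>S. maximum_stable_set G S \<longrightarrow> (\<exists>P. BE_path_partition G S P))"

definition BE_diperfect :: "('a, 'b) pre_digraph \<Rightarrow> bool" where
  "BE_diperfect G \<longleftrightarrow> (\<forall>H. induced_subgraph H G \<longrightarrow> BE_property H)"

definition is_source :: "('a, 'b) pre_digraph \<Rightarrow> 'a \<Rightarrow> bool" where
  "is_source G v \<longleftrightarrow> v \<in> verts G \<and> in_neighbors G v = {}"

definition is_sink :: "('a, 'b) pre_digraph \<Rightarrow> 'a \<Rightarrow> bool" where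
  "is_sink G v \<longleftrightarrow> v \<in> verts G \<and> out_neighbors G v = {}"

text \<open>
  The whole graph \<open>U\<close> is the undirected cycle running through \<open>xs\<close> in this cyclic order, so
  \<open>U\<close> has no chords. The notion \<^const>\<open>pre_digraph.cycle\<close> does not fit: it is a closed walk inside
  a digraph and admits length 2.
\<close>

definition is_cycle_graph :: "'a pair_pre_digraph \<Rightarrow> 'a list \<Rightarrow> bool" where
  "is_cycle_graph U xs \<longleftrightarrow>
     3 \<le> length xs \<and> distinct xs \<and> pverts U = set xs \<and>
     (\<forall>u v. (u, v) \<in> parcs U \<longleftrightarrow>
        (\<exists>i < length xs. {u, v} = {xs ! i, xs ! (Suc i mod length xs)}))"

text \<open>The vertices \<open>x\<^sub>1\<close> and \<open>x\<^sub>2\<close> are \<open>xs ! 0\<close> and \<open>xs ! 1\<close>.\<close>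

definition blocking_odd_cycle :: "('a, 'b) pre_digraph \<Rightarrow> bool" where
  "blocking_odd_cycle C \<longleftrightarrow>
     (\<exists>xs k. k \<ge> 1 \<and> length xs = 2 * k + 1 \<and> is_cycle_graph (mk_symmetric C) xs \<and>
        (is_source C (xs ! 0) \<or> is_sink C (xs ! 0)) \<and>
        (is_source C (xs ! 1) \<or> is_sink C (xs ! 1)))"

end

theory Submission
  imports Defs
begin

text \<open>
  All hypotheses pass to induced subdigraphs, so it is enough to find, for a maximum stable set \<open>S\<close>
  of \<open>G\<close>, one path partition of \<open>G\<close> in which every path meets \<open>S\<close> in a single vertex, one of its ends.
  This is done by induction on the number of vertices. Blocking odd cycles enter as triangles: a transitive
  triangle with no reversed arc is one, so every transitive triangle of \<open>G\<close> has a reversed arc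
  (\<open>transitive_triangle_has_reversed_arc\<close>).

  If every vertex reaches \<open>S\<close>, then all paths can be made to end in \<open>S\<close>. Starting
  from the one-vertex paths on \<open>S\<close>, take an arc from an uncovered vertex to a covered one; the tail of the arc can be inserted into the path that contains the head without
  moving the end of that path (\<open>insert_into_path_keeping_end\<close>).

  Otherwise the vertices that do not reach \<open>S\<close> contain a strong component \<open>B\<close> that no arc
  leaves. As \<open>S\<close> cannot be enlarged by a vertex \<open>b\<close> of \<open>B\<close>, some \<open>s \<in> S\<close> dominates \<open>b\<close>.
  In-semicompleteness makes every in-neighbor of \<open>B\<close> dominate the whole of \<open>B\<close>, and then the
  triangle condition forces all arcs of both orientations inside \<open>B\<close>, and inside the set \<open>Q\<close> of
  outer in-neighbors of \<open>B\<close>. Hence \<open>B \<union> Q\<close> is a clique of the underlying graph that contains \<open>b\<close>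
  and all its neighbors, it meets \<open>S\<close> in \<open>s\<close> alone, and it is spanned by a path that
  starts at \<open>s\<close>, runs through the rest of \<open>Q\<close> and then through \<open>B\<close>
  (\<open>simplicial_path_from_stable_vertex\<close>). Deleting a clique that is the closed neighborhood of one
  of its vertices lowers the stability number, so \<open>S - {s}\<close> is a maximum stable set of what remains
  (\<open>maximum_stable_set_delete\<close>), and the induction hypothesis partitions the rest.
\<close>


section \<open>Induced subdigraphs\<close>

lemma dominates_induce_iff:
  "u \<rightarrow>\<^bsub>G \<restriction> W\<^esub> v \<longleftrightarrow> u \<in> W \<and> v \<in> W \<and> u \<rightarrow>\<^bsub>G\<^esub> v"
  by (auto simp: arcs_ends_conv)

lemma adjacent_induce_iff:
  "adjacent (G \<restriction> W) u v \<longleftrightarrow> u \<in> W \<and> v \<in> W \<and> adjacent G u v"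
  by (auto simp: adjacent_def dominates_induce_iff)

lemma dominates_induced_iff:
  assumes "induced_subgraph H G"
  shows "u \<rightarrow>\<^bsub>H\<^esub> v \<longleftrightarrow> u \<in> verts H \<and> v \<in> verts H \<and> u \<rightarrow>\<^bsub>G\<^esub> v"
proof -
  have "tail H = tail G" "head H = head G"
    and "arcs H = {e \<in> arcs G. tail G e \<in> verts H \<and> head G e \<in> verts H}"
    using assms by (simp_all add: induced_subgraph_def subgraph_def compatible_def)
  then show ?thesis
    by (auto simp: arcs_ends_conv)
qed

lemma induced_subgraph_trans:
  assumes "induced_subgraph C H" and "induced_subgraph H G"
  shows "induced_subgraph C G"
proof
  show "subgraph C G"
    using assms subgraph_trans unfolding induced_subgraph_def by metis
  have "compatible G H" "verts C \<subseteq> verts H"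
    using assms by auto
  then show "arcs C = {e \<in> arcs G. tail G e \<in> verts C \<and> head G e \<in> verts C}"
    using assms by (auto simp: induced_subgraph_def compatible_def)
qed

lemma vpath_induceD: "vpath p (G \<restriction> W) \<Longrightarrow> W \<subseteq> verts G \<Longrightarrow> vpath p G"
  using dominates_induce_iff[of _ _ G W] by (auto simp: vpath_def vwalk_def)

lemma in_semicomplete_iff:
  assumes "wf_digraph G"
  shows "in_semicomplete G \<longleftrightarrow>
    (\<forall>u v w. u \<rightarrow>\<^bsub>G\<^esub> w \<and> v \<rightarrow>\<^bsub>G\<^esub> w \<and> u \<noteq> v \<longrightarrow> adjacent G u v)"
proof -
  have "w \<in> verts G" if "u \<rightarrow>\<^bsub>G\<^esub> w" for u w
    using wf_digraph.adj_in_verts(2)[OF assms that] .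
  then show ?thesis
    by (simp add: in_semicomplete_def semicomplete_def in_neighbors_def pairwise_def
          adjacent_induce_iff) metis
qed

lemma in_semicomplete_induced:
  assumes "wf_digraph G" "in_semicomplete G" "induced_subgraph H G"
  shows "in_semicomplete H"
proof -
  have "wf_digraph H"
    using assms(3) by (rule wf_digraphI_induced)
  then show ?thesis
    using assms(2) unfolding in_semicomplete_iff[OF \<open>wf_digraph H\<close>]
      in_semicomplete_iff[OF assms(1)] adjacent_def dominates_induced_iff[OF assms(3)]
    by metis
qed


section \<open>Transitive triangles\<close>

text \<open>
  The source \<open>a\<close> and the sink \<open>c\<close> of the triangle are the two consecutive distinguished vertices of
  the cycle; hence the cyclic order \<open>a, c, b\<close>.
\<close>

lemma (in digraph) transitive_triangle_blocking:
  assumes "a \<rightarrow> b" "b \<rightarrow> c" "a \<rightarrow> c" "\<not> b \<rightarrow> a" "\<not> c \<rightarrow> b" "\<not> c \<rightarrow> a"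
  shows "blocking_odd_cycle (G \<restriction> {a, b, c})"
proof -
  let ?C = "G \<restriction> {a, b, c}"
  have no_loop: "\<not> x \<rightarrow>\<^bsub>G\<^esub> x" for x
    by (auto simp: arcs_ends_conv dest: no_loops)
  have ne: "a \<noteq> b" "b \<noteq> c" "a \<noteq> c"
    using assms no_loop by auto
  have "adjacent ?C u v \<longleftrightarrow> {u, v} = {a, c} \<or> {u, v} = {c, b} \<or> {u, v} = {b, a}" for u v
  proof (cases "u \<in> {a, b, c} \<and> v \<in> {a, b, c}")
    case True
    then consider "u = v" | "{u, v} = {a, c}" | "{u, v} = {c, b}" | "{u, v} = {b, a}"
      by auto
    then show ?thesis
      using assms ne no_loop
      by cases (auto simp: adjacent_def dominates_induce_iff doubleton_eq_iff)
  next
    case False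
    then show ?thesis
      by (auto simp: adjacent_induce_iff doubleton_eq_iff)
  qed
  moreover have "(\<exists>i < length [a, c, b]. R i) \<longleftrightarrow> R 0 \<or> R 1 \<or> R 2" for R :: "nat \<Rightarrow> bool"
    by (auto simp: less_Suc_eq numeral_2_eq_2)
  ultimately have "(u, v) \<in> parcs (mk_symmetric ?C) \<longleftrightarrow>
      (\<exists>i < length [a, c, b]. {u, v} = {[a, c, b] ! i, [a, c, b] ! (Suc i mod length [a, c, b])})"
    for u v
    unfolding parcs_mk_symmetric_adjacent by (simp add: numeral_2_eq_2)
  then have cyc: "is_cycle_graph (mk_symmetric ?C) [a, c, b]"
    unfolding is_cycle_graph_def using ne by (auto simp: mk_symmetric_def)
  have "is_source ?C a" "is_sink ?C c"
    using assms no_loop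
    by (auto simp: is_source_def is_sink_def in_neighbors_def out_neighbors_def
          dominates_induce_iff)
  then show ?thesis
    unfolding blocking_odd_cycle_def using cyc
    by (intro exI[of _ "[a, c, b]"] exI[of _ 1]) auto
qed

lemma (in digraph) transitive_triangle_has_reversed_arc:
  assumes "\<nexists>C. induced_subgraph C G \<and> blocking_odd_cycle C"
    and "a \<rightarrow> b" "b \<rightarrow> c" "a \<rightarrow> c"
  shows "b \<rightarrow> a \<or> c \<rightarrow> b \<or> c \<rightarrow> a"
proof (rule ccontr)
  assume "\<not> ?thesis"
  then have "blocking_odd_cycle (G \<restriction> {a, b, c})"
    using transitive_triangle_blocking assms by metis
  moreover have "induced_subgraph (G \<restriction> {a, b, c}) G"
    using assms adj_in_verts by (intro induced_induce) auto
  ultimately show False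
    using assms(1) by metis
qed


section \<open>Paths ending in the stable set\<close>

text \<open>
  Let \<open>y\<close> be the predecessor of \<open>x\<close> on the path. Both \<open>y\<close> and \<open>v\<close> dominate \<open>x\<close>, so they are
  adjacent: either \<open>v\<close> fits between \<open>y\<close> and \<open>x\<close>, or \<open>v\<close> also dominates \<open>y\<close> and the
  argument moves one step back. At the start of the path, \<open>v\<close> is put in front.
\<close>

lemma (in wf_digraph) insert_into_path_keeping_end:
  assumes "in_semicomplete G" "vpath (ys @ x # zs) G" "v \<notin> set (ys @ x # zs)" "v \<rightarrow> x"
  shows "\<exists>q. vpath q G \<and> set q = insert v (set (ys @ x # zs)) \<and> last q = last (x # zs)"
  using assms(2-)
proof (induction ys arbitrary: x zs rule: rev_induct)
  case Nil
  then have "vpath (v # x # zs) G"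
    using adj_in_verts by (auto simp: vpath_def vwalk_def)
  then show ?case
    by (intro exI[of _ "v # x # zs"]) auto
next
  case (snoc y ys)
  have "y \<rightarrow> x"
    using snoc.prems(1) vwalk_arcs_append[of "ys @ [y]" "x # zs"] by (auto simp: vpath_def vwalk_def)
  then consider "y \<rightarrow> v" | "v \<rightarrow> y"
    using snoc.prems assms(1) wf_digraph_axioms by (auto simp: in_semicomplete_iff adjacent_def)
  then show ?case
  proof cases
    case 1
    have "vpath ((ys @ [y]) @ v # x # zs) G"
      using 1 snoc.prems adj_in_verts vwalk_arcs_append[of "ys @ [y]" "x # zs"]
        vwalk_arcs_append[of "ys @ [y]" "v # x # zs"]
      by (auto simp: vpath_def vwalk_def)
    then show ?thesis
      by (intro exI[of _ "(ys @ [y]) @ v # x # zs"]) auto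
  next
    case 2
    then show ?thesis
      using snoc.IH[of y "x # zs"] snoc.prems by auto
  qed
qed

text \<open>
  A partial path partition with all stable vertices at the ends: a \<open>BE_path_partition\<close> in which the
  end is always the last vertex, and which covers only \<open>U\<close>.
\<close>

definition paths_into :: "('a, 'b) pre_digraph \<Rightarrow> 'a set \<Rightarrow> 'a set \<Rightarrow> 'a list set \<Rightarrow> bool" where
  "paths_into G S U P \<longleftrightarrow> (\<forall>p \<in> P. vpath p G \<and> set p \<inter> S = {last p}) \<and>
     disjoint_family_on set P \<and> (\<Union>p \<in> P. set p) = U"

lemma (in wf_digraph) paths_into_insert:
  assumes "in_semicomplete G" "paths_into G S U P" "S \<subseteq> U" "v \<notin> U" "x \<in> U" "v \<rightarrow> x"
  shows "\<exists>P'. paths_into G S (insert v U) P'"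
proof -
  obtain p where p: "p \<in> P" "x \<in> set p"
    using assms by (auto simp: paths_into_def)
  then have path: "vpath p G" "set p \<inter> S = {last p}" "set p \<subseteq> U"
    using assms by (auto simp: paths_into_def)
  obtain ys zs where "p = ys @ x # zs"
    using p split_list by metis
  moreover have "v \<notin> set p"
    using path(3) assms(4) by blast
  ultimately obtain q where q: "vpath q G" "set q = insert v (set p)" "last q = last p"
    using insert_into_path_keeping_end[of ys x zs v] assms(1,6) path(1)
    by (metis last_appendR list.distinct(1))
  have disj: "set r \<inter> set p = {}" if "r \<in> P - {p}" for r
    using assms that p by (auto simp: paths_into_def disjoint_family_on_def)
  have "disjoint_family_on set (insert q (P - {p}))"
    using assms disj unfolding disjoint_family_on_def paths_into_def
    by (auto simp: q(2))
  moreover have "(\<Union>r \<in> insert q (P - {p}). set r) = insert v U"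
    using assms p q by (auto simp: paths_into_def)
  moreover have "set q \<inter> S = {last q}"
    using q path assms by auto
  ultimately have "paths_into G S (insert v U) (insert q (P - {p}))"
    using assms q unfolding paths_into_def by auto
  then show ?thesis ..
qed

text \<open>
  A largest coverable set containing \<open>S\<close> is everything: a walk to \<open>S\<close> from an uncovered vertex
  enters the covered set by some arc, and the tail of that arc could be added.
\<close>

lemma (in fin_digraph) paths_into_if_all_reach:
  assumes "in_semicomplete G" "S \<subseteq> verts G" "\<And>v. v \<in> verts G \<Longrightarrow> \<exists>s \<in> S. v \<rightarrow>\<^sup>* s"
  shows "\<exists>P. paths_into G S (verts G) P"
proof -
  define \<U> where "\<U> = {U. S \<subseteq> U \<and> U \<subseteq> verts G \<and> (\<exists>P. paths_into G S U P)}"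
  have "paths_into G S S ((\<lambda>s. [s]) ` S)"
    using assms(2) by (auto simp: paths_into_def vpath_def vwalk_def disjoint_family_on_def)
  then have "S \<in> \<U>"
    using assms(2) by (auto simp: \<U>_def)
  moreover have "finite \<U>"
    by (rule finite_subset[of _ "Pow (verts G)"]) (auto simp: \<U>_def)
  ultimately obtain U where U: "U \<in> \<U>" and max: "\<And>U'. U' \<in> \<U> \<Longrightarrow> U \<subseteq> U' \<Longrightarrow> U' = U"
    using finite_has_maximal[of \<U>] by blast
  have "U = verts G"
  proof (rule ccontr)
    assume "U \<noteq> verts G"
    then obtain v where v: "v \<in> verts G" "v \<notin> U"
      using U by (auto simp: \<U>_def)
    have "S \<subseteq> U"
      using U by (simp add: \<U>_def)
    then obtain s where "s \<in> U" "v \<rightarrow>\<^sup>* s"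
      using assms(3)[OF v(1)] by blast
    from this(2) v(2) \<open>s \<in> U\<close> have "\<exists>w x. w \<notin> U \<and> x \<in> U \<and> w \<rightarrow> x"
      by (induction rule: converse_reachable_induct) auto
    then obtain w x where wx: "w \<notin> U" "x \<in> U" "w \<rightarrow> x"
      by blast
    have "insert w U \<in> \<U>"
      using paths_into_insert[OF assms(1), of S U _ w x] U wx adj_in_verts by (auto simp: \<U>_def)
    then show False
      using max wx by blast
  qed
  then show ?thesis
    using U by (auto simp: \<U>_def)
qed


section \<open>Terminal components that miss the stable set\<close>

lemma vpath_of_clique:
  assumes "distinct p" "p \<noteq> []" "set p \<subseteq> verts G"
    and "\<And>u v. u \<in> set p \<Longrightarrow> v \<in> set p \<Longrightarrow> u \<noteq> v \<Longrightarrow> u \<rightarrow>\<^bsub>G\<^esub> v"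
  shows "vpath p G"
proof -
  have "set (vwalk_arcs p) \<subseteq> arcs_ends G"
    using assms(1,4) by (induction p rule: vwalk_arcs.induct) auto
  then show ?thesis
    using assms by (auto simp: vpath_def vwalk_def)
qed

text \<open>
  For nonempty \<open>B\<close> this says that \<open>B\<close> is the vertex set of a strong component without leaving arcs.
\<close>

definition terminal_component :: "('a, 'b) pre_digraph \<Rightarrow> 'a set \<Rightarrow> bool" where
  "terminal_component G B \<longleftrightarrow> B \<subseteq> verts G \<and> (\<forall>u \<in> B. \<forall>v. u \<rightarrow>\<^bsub>G\<^esub> v \<longrightarrow> v \<in> B) \<and>
     (\<forall>u \<in> B. \<forall>v \<in> B. u \<rightarrow>\<^sup>*\<^bsub>G\<^esub> v)"

text \<open>
  Domination by \<open>a\<close> spreads against the arcs of \<open>B\<close>: if \<open>x \<rightarrow> y\<close> in \<open>B\<close> and \<open>a \<rightarrow> y\<close>, then \<open>x\<close> and \<open>a\<close>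
  are adjacent, and the arc cannot go from \<open>x\<close> to \<open>a\<close> because no arc leaves \<open>B\<close>. Strong
  connectedness carries it to all of \<open>B\<close>.
\<close>

lemma (in wf_digraph) terminal_component_dominated_uniformly:
  assumes "in_semicomplete G" and B: "terminal_component G B"
    and a: "a \<notin> B" "w \<in> B" "a \<rightarrow> w" and "u \<in> B"
  shows "a \<rightarrow> u"
proof -
  have closed: "y \<in> B" if "x \<in> B" "x \<rightarrow> y" for x y
    using that B by (auto simp: terminal_component_def)
  have "u \<rightarrow>\<^sup>* w"
    using B a \<open>u \<in> B\<close> by (auto simp: terminal_component_def)
  then show ?thesis
    using \<open>u \<in> B\<close>
  proof (induction rule: converse_reachable_induct)
    case base
    show ?case by (rule a)
  next
    case (step x y)
    then have "a \<rightarrow> y" "x \<noteq> a" "\<not> x \<rightarrow> a"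
      using closed a by blast+
    then show ?case
      using step(1) assms(1) unfolding in_semicomplete_iff[OF wf_digraph_axioms] adjacent_def
      by metis
  qed
qed

text \<open>
  An arc \<open>x \<rightarrow> y\<close> of \<open>B\<close> forms a transitive triangle with \<open>a\<close>, whose only reversible arc is \<open>x \<rightarrow> y\<close>
  itself; so \<open>B\<close> is symmetric. In a symmetric in-semicomplete digraph any two neighbors
  of a vertex are adjacent, so being joined by a walk already means being adjacent.
\<close>

lemma (in digraph) dominated_terminal_component_complete:
  assumes "in_semicomplete G"
    and noblock: "\<nexists>C. induced_subgraph C G \<and> blocking_odd_cycle C"
    and B: "terminal_component G B"
    and a: "a \<notin> B" "w \<in> B" "a \<rightarrow> w"
    and uv: "u \<in> B" "v \<in> B" "u \<noteq> v"
  shows "u \<rightarrow> v"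
proof -
  have closed: "y \<in> B" if "x \<in> B" "x \<rightarrow> y" for x y
    using that B by (auto simp: terminal_component_def)
  have symmetric: "y \<rightarrow> x" if "x \<in> B" "x \<rightarrow> y" for x y
  proof -
    have "a \<rightarrow> x" "a \<rightarrow> y"
      using that closed terminal_component_dominated_uniformly[OF assms(1) B a] by blast+
    then show ?thesis
      using transitive_triangle_has_reversed_arc[OF noblock, of a x y] that closed a(1) by blast
  qed
  have "u \<rightarrow>\<^sup>* v"
    using uv B by (auto simp: terminal_component_def)
  then have "v = u \<or> u \<rightarrow> v"
  proof (induction rule: reachable_induct)
    case base
    show ?case by simp
  next
    case (step x y)
    show ?case
    proof (cases "x = u \<or> y = u")
      case True
      then show ?thesis
        using step by auto
    next
      case False
      then have "u \<rightarrow> x" "x \<in> B"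
        using step closed uv by auto
      then have "y \<rightarrow> x"
        using symmetric step by blast
      then have "u \<rightarrow> y \<or> y \<rightarrow> u"
        using \<open>u \<rightarrow> x\<close> False assms(1)
        unfolding in_semicomplete_iff[OF wf_digraph_axioms] adjacent_def by metis
      then show ?thesis
        using symmetric closed step \<open>x \<in> B\<close> by blast
    qed
  qed
  then show ?thesis
    using uv by simp
qed

text \<open>
  In the transitive triangle \<open>v \<rightarrow> u \<rightarrow> b\<close> only the arc \<open>v \<rightarrow> u\<close> can be reversed, since no arc leaves
  \<open>B\<close>.
\<close>

lemma (in digraph) dominators_of_terminal_component_complete:
  assumes "in_semicomplete G"
    and noblock: "\<nexists>C. induced_subgraph C G \<and> blocking_odd_cycle C"
    and B: "terminal_component G B" "b \<in> B"
    and u: "u \<notin> B" "u \<rightarrow> b" and v: "v \<notin> B" "v \<rightarrow> b" and "u \<noteq> v"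
  shows "u \<rightarrow> v"
proof (rule ccontr)
  assume *: "\<not> u \<rightarrow> v"
  then have "v \<rightarrow> u"
    using assms(1) u v \<open>u \<noteq> v\<close>
    unfolding in_semicomplete_iff[OF wf_digraph_axioms] adjacent_def by metis
  moreover have "\<not> b \<rightarrow> u" "\<not> b \<rightarrow> v"
    using B u v by (auto simp: terminal_component_def)
  ultimately show False
    using transitive_triangle_has_reversed_arc[OF noblock, of v u b] * u v by blast
qed

text \<open>
  A vertex of \<open>X\<close> whose set of reachable vertices is as small as possible can be
  reached back from each of them, so these vertices form the component.
\<close>

lemma (in fin_digraph) terminal_component_within:
  assumes "X \<subseteq> verts G" "X \<noteq> {}" and closed: "\<And>u v. u \<in> X \<Longrightarrow> u \<rightarrow> v \<Longrightarrow> v \<in> X"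
  obtains B where "B \<subseteq> X" "B \<noteq> {}" "terminal_component G B"
proof -
  let ?R = "\<lambda>u. {w. u \<rightarrow>\<^sup>* w}"
  obtain b where b: "b \<in> X" and min: "\<And>u. u \<in> X \<Longrightarrow> card (?R b) \<le> card (?R u)"
    using ex_has_least_nat[of "\<lambda>u. u \<in> X" _ "\<lambda>u. card (?R u)"] assms(2) by blast
  have RX: "u \<in> X" if "b \<rightarrow>\<^sup>* u" for u
    using that b closed by (induction rule: reachable_induct) auto
  have "u \<rightarrow>\<^sup>* b" if "b \<rightarrow>\<^sup>* u" for u
  proof -
    have "finite (?R b)"
      by (rule finite_subset[of _ "verts G"]) (auto dest: reachable_in_verts)
    moreover have "?R u \<subseteq> ?R b"
      using that reachable_trans by blast
    ultimately have "?R u = ?R b"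
      using min[OF RX[OF that]] by (metis card_seteq)
    then show ?thesis
      using b assms(1) by auto
  qed
  then have "terminal_component G (?R b)"
    unfolding terminal_component_def
    using reachable_trans reachable_adj_trans reachable_in_verts(2) by blast
  moreover have "?R b \<subseteq> X" "?R b \<noteq> {}"
    using RX b assms(1) by auto
  ultimately show thesis
    using that by blast
qed

lemma (in fin_digraph) maximum_stable_set_dominates:
  assumes "maximum_stable_set G S" "b \<in> verts G" "b \<notin> S"
  obtains s where "s \<in> S" "adjacent G b s"
proof -
  have S: "S \<subseteq> verts G" "pairwise (\<lambda>u v. \<not> adjacent G u v) S"
    using assms by (auto simp: maximum_stable_set_def stable_set_def)
  have "\<not> stable_set G (insert b S)"
  proof
    assume "stable_set G (insert b S)"
    then have "card (insert b S) \<le> card S"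
      using assms by (auto simp: maximum_stable_set_def)
    then show False
      using assms(3) finite_subset[OF S(1)] by (auto simp: card_insert_if)
  qed
  then show thesis
    using that S assms(2) by (auto simp: stable_set_def pairwise_insert adjacent_def)
qed

text \<open>
  With \<open>b\<close> taken from a terminal component outside \<open>S\<close>, the path runs through the closed neighborhood
  of \<open>b\<close>, a clique. That the path contains \<open>b\<close> and all its neighbors is what makes the stability
  number drop when the path is deleted.
\<close>

lemma (in digraph) simplicial_path_from_stable_vertex:
  assumes "in_semicomplete G"
    and noblock: "\<nexists>C. induced_subgraph C G \<and> blocking_odd_cycle C"
    and S: "maximum_stable_set G S"
    and unreach: "\<exists>v \<in> verts G. \<forall>s \<in> S. \<not> v \<rightarrow>\<^sup>* s"
  obtains b p where "vpath p G" "set p \<inter> S = {hd p}"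
    "b \<in> verts G" "b \<in> set p" "{u. adjacent G b u} \<subseteq> set p"
proof -
  have SV: "S \<subseteq> verts G" and stable: "pairwise (\<lambda>u v. \<not> adjacent G u v) S"
    using S by (auto simp: maximum_stable_set_def stable_set_def)
  define X where "X = {v \<in> verts G. \<forall>s \<in> S. \<not> v \<rightarrow>\<^sup>* s}"
  have "X \<subseteq> verts G" "X \<noteq> {}"
    using unreach by (auto simp: X_def)
  moreover have "v \<in> X" if "u \<in> X" "u \<rightarrow> v" for u v
    using that adj_reachable_trans adj_in_verts by (auto simp: X_def)
  ultimately obtain B where BX: "B \<subseteq> X" and "B \<noteq> {}" and B: "terminal_component G B"
    using terminal_component_within[of X] by metis
  then obtain b where bB: "b \<in> B"
    by auto
  have BV: "B \<subseteq> verts G" and BS: "B \<inter> S = {}"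
    using BX by (auto simp: X_def)
  have closed: "v \<in> B" if "u \<in> B" "u \<rightarrow> v" for u v
    using that B by (auto simp: terminal_component_def)
  obtain s where s: "s \<in> S" "adjacent G b s"
    using maximum_stable_set_dominates[OF S, of b] bB BV BS by blast
  then have sB: "s \<notin> B" "s \<rightarrow> b"
    using closed bB BS by (auto simp: adjacent_def)
  define Q where "Q = {a. a \<notin> B \<and> a \<rightarrow> b}"
  have sQ: "s \<in> Q"
    using sB by (simp add: Q_def)
  have QB: "a \<rightarrow> u" if "a \<in> Q" "u \<in> B" for a u
    using that terminal_component_dominated_uniformly[OF assms(1) B _ bB] by (simp add: Q_def)
  have cliqueB: "u \<rightarrow> v" if "u \<in> B" "v \<in> B" "u \<noteq> v" for u v
    using dominated_terminal_component_complete[OF assms(1) noblock B sB(1) bB sB(2) that] .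
  have cliqueQ: "u \<rightarrow> v" if "u \<in> Q" "v \<in> Q" "u \<noteq> v" for u v
    using that dominators_of_terminal_component_complete[OF assms(1) noblock B bB]
    by (simp add: Q_def)
  have QV: "Q \<subseteq> verts G"
    using adj_in_verts by (auto simp: Q_def)
  obtain qs where qs: "distinct qs" "set qs = Q - {s}"
    using finite_subset[OF QV finite_verts] finite_distinct_list[of "Q - {s}"] by auto
  obtain bs where bs: "distinct bs" "set bs = B"
    using finite_subset[OF BV finite_verts] finite_distinct_list by blast
  have set_sqs: "set (s # qs) = Q"
    using qs sQ by auto
  have "vpath (s # qs) G"
  proof (rule vpath_of_clique)
    show "distinct (s # qs)"
      using qs by simp
  qed (use cliqueQ QV set_sqs in auto)
  moreover have "vpath bs G"
    using bs bB cliqueB BV by (intro vpath_of_clique) auto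
  moreover have "last (s # qs) \<rightarrow> hd bs"
  proof (rule QB)
    show "last (s # qs) \<in> Q"
      using last_in_set[of "s # qs"] set_sqs by blast
    show "hd bs \<in> B"
      using hd_in_set[of bs] bs bB by fastforce
  qed
  moreover have "set (s # qs) \<inter> set bs = {}"
    unfolding set_sqs using bs by (auto simp: Q_def)
  ultimately have path: "vpath ((s # qs) @ bs) G"
    using bs bB vwalk_arcs_append[of "s # qs" bs]
    by (auto simp: vpath_def vwalk_def simp del: last.simps)
  have Q_S: "Q \<inter> S = {s}"
    using sQ s cliqueQ stable by (auto simp: pairwise_def adjacent_def)
  have set: "set ((s # qs) @ bs) = Q \<union> B"
    using set_sqs bs by auto
  show thesis
  proof (rule that)
    show "vpath ((s # qs) @ bs) G"
      by (rule path)
    show "set ((s # qs) @ bs) \<inter> S = {hd ((s # qs) @ bs)}"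
      unfolding set using Q_S BS by auto
    show "b \<in> verts G" "b \<in> set ((s # qs) @ bs)"
      unfolding set using bB BV by auto
    show "{u. adjacent G b u} \<subseteq> set ((s # qs) @ bs)"
      unfolding set using closed bB by (auto simp: adjacent_def Q_def)
  qed
qed

lemma BE_path_partition_extend:
  assumes P: "BE_path_partition (G \<restriction> (verts G - set p)) (S - {hd p}) P"
    and p: "vpath p G" "set p \<inter> S = {hd p}"
  shows "BE_path_partition G S (insert p P)"
proof -
  let ?H = "G \<restriction> (verts G - set p)"
  have cover: "(\<Union>q \<in> P. set q) = verts G - set p"
    and disj: "disjoint_family_on set P"
    using P by (auto simp: BE_path_partition_def path_partition_def)
  have "set p \<subseteq> verts G"
    using p by (auto simp: vpath_def vwalk_def)
  moreover have "disjoint_family_on set (insert p P)"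
    using disj cover unfolding disjoint_family_on_def by auto
  moreover have "vpath q G" if "q \<in> P" for q
    using that P vpath_induceD[of q G] by (auto simp: BE_path_partition_def path_partition_def)
  ultimately have "path_partition G (insert p P)"
    using cover p by (auto simp: path_partition_def)
  moreover have "\<exists>x. set q \<inter> S = {x} \<and> x \<in> {hd q, last q}" if "q \<in> P" for q
  proof -
    have "hd p \<notin> set q"
      using that cover p by auto
    then have "set q \<inter> S = set q \<inter> (S - {hd p})"
      by auto
    then show ?thesis
      using that P by (simp add: BE_path_partition_def)
  qed
  ultimately show ?thesis
    using p by (auto simp: BE_path_partition_def)
qed

text \<open>
  A stable set outside \<open>K\<close> can be enlarged by \<open>b\<close>, so its size is less than that of \<open>S\<close>.
\<close>

lemma maximum_stable_set_delete:
  assumes "finite (verts G)" "maximum_stable_set G S" "b \<in> verts G" "b \<in> K" "K \<inter> S = {s}"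
    and nbrs: "{u. adjacent G b u} \<subseteq> K"
  shows "maximum_stable_set (G \<restriction> (verts G - K)) (S - {s})"
proof -
  let ?H = "G \<restriction> (verts G - K)"
  have S: "S \<subseteq> verts G" "pairwise (\<lambda>u v. \<not> adjacent G u v) S"
    using assms by (auto simp: maximum_stable_set_def stable_set_def)
  have "stable_set ?H (S - {s})"
    using S assms by (auto simp: stable_set_def pairwise_def adjacent_induce_iff)
  moreover have "card T \<le> card (S - {s})" if T: "stable_set ?H T" for T
  proof -
    have "stable_set G (insert b T)"
      using T nbrs assms(3)
      by (auto simp: stable_set_def pairwise_insert pairwise_def adjacent_def
          dominates_induce_iff subset_iff)
    then have "card (insert b T) \<le> card S"
      using assms(2) by (auto simp: maximum_stable_set_def)
    moreover have "T \<subseteq> verts G" "b \<notin> T" "s \<in> S"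
      using T assms(4,5) by (auto simp: stable_set_def)
    moreover have "finite T" "finite S"
      using finite_subset[OF _ assms(1)] S(1) \<open>T \<subseteq> verts G\<close> by auto
    ultimately show ?thesis
      by auto
  qed
  ultimately show ?thesis
    by (auto simp: maximum_stable_set_def)
qed


section \<open>Removing simplicial neighborhoods one after another\<close>

lemma BE_property_of_in_semicomplete:
  fixes G :: "('a, 'b) pre_digraph"
  assumes "digraph G" "in_semicomplete G" "\<nexists>C. induced_subgraph C G \<and> blocking_odd_cycle C"
  shows "BE_property G"
  using assms
proof (induction "card (verts G)" arbitrary: G rule: less_induct)
  case less
  then interpret digraph G by simp
  show ?case
    unfolding BE_property_def
  proof (intro allI impI)
    fix S assume S: "maximum_stable_set G S"
    show "\<exists>P. BE_path_partition G S P"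
    proof (cases "\<forall>v \<in> verts G. \<exists>s \<in> S. v \<rightarrow>\<^sup>*\<^bsub>G\<^esub> s")
      case True
      then obtain P where "paths_into G S (verts G) P"
        using paths_into_if_all_reach[OF less.prems(2), of S] S
        by (auto simp: maximum_stable_set_def stable_set_def)
      then have "BE_path_partition G S P"
        by (auto simp: paths_into_def BE_path_partition_def path_partition_def)
      then show ?thesis ..
    next
      case False
      then have "\<exists>v \<in> verts G. \<forall>s \<in> S. \<not> v \<rightarrow>\<^sup>*\<^bsub>G\<^esub> s"
        by blast
      then obtain b p where p: "vpath p G" "set p \<inter> S = {hd p}"
          "b \<in> verts G" "b \<in> set p" "{u. adjacent G b u} \<subseteq> set p"
        by (rule simplicial_path_from_stable_vertex[OF less.prems(2,3) S])
      let ?H = "G \<restriction> (verts G - set p)"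
      have ind: "induced_subgraph ?H G"
        by (rule induced_induce) auto
      have "maximum_stable_set ?H (S - {hd p})"
        by (rule maximum_stable_set_delete[OF finite_verts S p(3,4,2,5)])
      moreover have "BE_property ?H"
      proof (rule less.hyps)
        show "card (verts ?H) < card (verts G)"
          using p(3,4) by (auto intro!: psubset_card_mono)
        show "\<nexists>C. induced_subgraph C ?H \<and> blocking_odd_cycle C"
          using induced_subgraph_trans[OF _ ind] less.prems(3) by metis
      qed (use ind less.prems digraphI_induced in_semicomplete_induced wf_digraph_axioms in metis)+
      ultimately obtain P where "BE_path_partition ?H (S - {hd p}) P"
        by (auto simp: BE_property_def)
      then show ?thesis
        using BE_path_partition_extend[OF _ p(1,2)] by blast
    qed
  qed
qed

theorem theorem6p5:
  fixes D :: "('a, 'b) pre_digraph"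
  assumes "digraph D"
    and "in_semicomplete D"
    and "\<nexists>C. induced_subgraph C D \<and> blocking_odd_cycle C"
  shows "BE_diperfect D"
  unfolding BE_diperfect_def
proof (intro allI impI)
  fix H assume H: "induced_subgraph H D"
  interpret digraph D by fact
  show "BE_property H"
  proof (rule BE_property_of_in_semicomplete)
    show "\<nexists>C. induced_subgraph C H \<and> blocking_odd_cycle C"
      using induced_subgraph_trans[OF _ H] assms(3) by metis
  qed (use H assms digraphI_induced in_semicomplete_induced wf_digraph_axioms in metis)+
qed

end
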